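(* Let $\mathbf{B}\in\{0,1\}^{n\times n}$ be a $d$-regular adjacency matrix for a directed graph $\mathcal{G}$ on $n$ vertices. Let $\mathbf{B}$ be decomposed as $\mathbf{B}=\mathbf{U}\,\mathrm{diag}\{\boldsymbol{\lambda}(\mathbf{B})\}\,\mathbf{V}^{*}$ where $\mathbf{U}\mathbf{V}^{*}=\mathbf{I}$. Let $\lambda_{\ell}(\mathbf{B})=\alpha_{\ell}e^{i\theta_{\ell}}$, with $\alpha_{\ell}\in\mathbb{R}$ and $\theta_{\ell}\in[0,2\pi)$, be a polar decomposition of $\boldsymbol{\lambda}(\mathbf{B})$, and let $\boldsymbol{\alpha}(\mathbf{B})=(\alpha_{0},\dots,\alpha_{n-1})$. Let $\mathbf{f},\mathbf{g}\in\{0,1\}^{n\times1}$ be such that there exist $\mathbf{F},\mathbf{G}\in\mathbb{C}^{n\times1}$ satisfying $$\mathbf{f}=\mathbf{V}\overline{\mathbf{F}},\qquad \mathbf{g}=\mathbf{U}\mathbf{G},\qquad\text{such that for all }0\le\ell<n,\ \ \mathbf{F}[\ell]\mathbf{G}[\ell]e^{i\theta_{\ell}}\ge0.$$ Then if $\mathbf{f}$ and $\mathbf{g}$ denote respectively indicator vectors for rows and columns associated with a rectangular zero block in $\mathbf{B}$, $$\frac{\|\mathbf{f}\|_{2}^{2}\,\|\mathbf{g}\|_{2}^{2}}{n}\le\frac{-\min\{\boldsymbol{\alpha}(\mathbf{B})\}\sum_{0\le\ell<n}\mathbf{F}[\ell]\mathbf{G}[\ell]e^{i\theta_{\ell}}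}{d-\min\{\boldsymbol{\alpha}(\mathbf{B})\}}.$$
   Context: The adjacency matrix of a directed, unweighted graph $\mathcal{G}$ on $n$ vertices is $\mathbf{B}\in\{0,1\}^{n\times n}$ with $\mathbf{B}[i,j]=1$ if and only if there is a directed edge from the $i$-th node to the $j$-th node. The graph (and its adjacency matrix) is $d$-regular if all row sums and all column sums of $\mathbf{B}$ are equal to $d$. In the decomposition, $\mathbf{U},\mathbf{V}\in\mathbb{C}^{n\times n}$ and $\boldsymbol{\lambda}(\mathbf{B})=(\lambda_\ell(\mathbf{B}))_{0\le\ell<n}\subset\mathbb{C}$ is the tuple of eigenvalues of $\mathbf{B}$. The vectors $\mathbf{f},\mathbf{g}\in\{0,1\}^{n\times 1}$ are indicator vectors for rows and columns associated with a rectangular zero block in $\mathbf{B}$ if $\mathbf{B}[i,j]=0$ whenever $\mathbf{f}[i]=1$ and $\mathbf{g}[j]=1$. Indices run over $0,\dots,n-1$; $^{*}$ is conjugate transpose; $\overline{\mathbf{F}}$ is the entrywise conjugate; $\mathrm{diag}\{\boldsymbol{\lambda}\}$ is the diagonal matrix with $\ell$-th diagonal entry $\lambda_\ell$; $\mathbf{I}$ is the identity matrix; for a complex number, "$\ge 0$" means real and nonnegative.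
   Formalization: Added: d > 0 (for d = 0 the bound is 0/0), and for some index the columns of U and V are both multiples of the all-ones vector; without this it fails, e.g. B = U = V = I (n = 2), α = (1,−1), θ = (0,π), f = e_0, g = e_1. It is automatic when the graph is connected. *)

theory Defs
  imports
    "Jordan_Normal_Form.Schur_Decomposition"
    "HOL-Analysis.L2_Norm"
begin

text \<open>
  Matrices and vectors are those of Jordan_Normal_Form, indexed by \<open>0, \<dots>, n - 1\<close>.  The order on
  type \<open>complex\<close> is the one of \<open>Complex_Order\<close>: \<open>w \<le> z\<close> says that \<open>z - w\<close> is real and
  nonnegative.
\<close>

text \<open>A directed graph on the vertices \<open>0, \<dots>, n - 1\<close> is given by its edge set \<open>E\<close>; loops are allowed.\<close>

definition adjacency_matrix :: "nat \<Rightarrow> (nat \<times> nat) set \<Rightarrow> complex mat" where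
  "adjacency_matrix n E = mat n n (\<lambda>(i, j). if (i, j) \<in> E then 1 else 0)"

definition regular_matrix :: "nat \<Rightarrow> nat \<Rightarrow> complex mat \<Rightarrow> bool" where
  "regular_matrix n d B \<longleftrightarrow> B \<in> carrier_mat n n \<and>
     (\<forall>i<n. (\<Sum>j<n. B $$ (i, j)) = of_nat d) \<and>
     (\<forall>j<n. (\<Sum>i<n. B $$ (i, j)) = of_nat d)"

definition indicator_vec :: "nat \<Rightarrow> complex vec \<Rightarrow> bool" where
  "indicator_vec n f \<longleftrightarrow> f \<in> carrier_vec n \<and> (\<forall>i<n. f $ i \<in> {0, 1})"

definition zero_block :: "nat \<Rightarrow> complex mat \<Rightarrow> complex vec \<Rightarrow> complex vec \<Rightarrow> bool" where
  "zero_block n B f g \<longleftrightarrow> (\<forall>i<n. \<forall>j<n. f $ i = 1 \<and> g $ j = 1 \<longrightarrow> B $$ (i, j) = 0)"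

definition norm2_vec :: "complex vec \<Rightarrow> real" where
  "norm2_vec v = L2_set (\<lambda>i. cmod (v $ i)) {..<dim_vec v}"

text \<open>
  In \<open>U * diag \<lambda> * V\<^sup>*\<close> with \<open>U * V\<^sup>* = I\<close>, column \<open>l\<close> of \<open>U\<close> is a right and column \<open>l\<close> of \<open>V\<close> a left
  eigenvector for \<open>\<lambda> l\<close>.  The all-ones vector is a right and a left eigenvector of a \<open>d\<close>-regular
  matrix for the eigenvalue \<open>d\<close>; the following says that it is, up to scaling, the pair of
  eigenvectors at one of the indices.  When \<open>d\<close> is a simple eigenvalue (for example, when the
  graph is connected) this holds automatically.  When \<open>d\<close> is a multiple eigenvalue it
  restricts the choice of basis of the eigenspace.
\<close>

definition has_constant_eigenpair :: "nat \<Rightarrow> complex mat \<Rightarrow> complex mat \<Rightarrow> bool" where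
  "has_constant_eigenpair n U V \<longleftrightarrow>
     (\<exists>l<n. \<exists>a b. col U l = a \<cdot>\<^sub>v vec n (\<lambda>_. 1) \<and> col V l = b \<cdot>\<^sub>v vec n (\<lambda>_. 1))"

end

theory Submission
  imports Defs
begin

text \<open>
  The bound is a weighted-average argument in spectral coordinates.  Put
  \<open>w l = F l * G l * exp (\<i> * \<theta> l)\<close>, which is nonnegative by hypothesis.  Since \<open>V\<^sup>* U = I\<close>, the
  columns of \<open>V\<close> and of \<open>U\<close> are dual bases, in which \<open>f\<close> and \<open>g\<close> have the coordinates
  \<open>conjugate F\<close> and \<open>G\<close>, so the number
  of edges from \<open>f\<close> to \<open>g\<close> is \<open>f\<^sup>* B g = (\<Sum>l. eigs l * F l * G l) = (\<Sum>l. \<alpha> l * w l)\<close>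
  (\<open>scalar_prod_dual_basis\<close>, \<open>diagonalized_mult_vec\<close>).  The zero block makes this sum vanish.

  At the index \<open>k\<close> of the constant eigenvectors, the eigenvalue is \<open>d\<close>, and the product \<open>F k * G k\<close>
  does not depend on how the eigenvectors are scaled: it is \<open>|f| * |g| / n\<close>, where \<open>|f|\<close> and \<open>|g|\<close>
  count the ones, that is \<open>\<parallel>f\<parallel>\<^sup>2\<close> and \<open>\<parallel>g\<parallel>\<^sup>2\<close> (\<open>constant_eigenpair_coefficients\<close>).  It is
  nonnegative and has the same modulus as \<open>w k\<close>, so it equals \<open>w k\<close>.  Estimating every other
  \<open>\<alpha> l\<close> from below by the minimum \<open>m\<close> gives \<open>0 \<ge> d * w k + m * ((\<Sum>l. w l) - w k)\<close>, which rearranges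
  to the claim (\<open>weight_le_of_balanced_sum\<close>).

  The polar decomposition lets \<open>\<alpha> k\<close> be \<open>d\<close> or \<open>- d\<close>.  Both cases are covered by the identity
  \<open>\<alpha> k * w k = eigs k * F k * G k = d * w k\<close>, which forces \<open>w k = 0\<close> when \<open>\<alpha> k = - d\<close>.
\<close>

section \<open>Adjoints and dual bases\<close>

lemma mat_adjoint_carrier:
  "A \<in> carrier_mat n m \<Longrightarrow> mat_adjoint A \<in> carrier_mat m n"
  unfolding mat_adjoint_def by auto

lemma mat_adjoint_index:
  "A \<in> carrier_mat n m \<Longrightarrow> i < m \<Longrightarrow> j < n \<Longrightarrow> mat_adjoint A $$ (i, j) = conjugate (A $$ (j, i))"
  unfolding mat_adjoint_def by (auto simp: mat_of_rows_index)

lemma scalar_prod_mat_adjoint: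
  fixes A :: "complex mat"
  assumes A: "A \<in> carrier_mat n m" and x: "x \<in> carrier_vec m" and y: "y \<in> carrier_vec n"
  shows "conjugate (A *\<^sub>v x) \<bullet> y = conjugate x \<bullet> (mat_adjoint A *\<^sub>v y)"
proof -
  note carrier = A x y mat_adjoint_carrier[OF A]
  have "conjugate (A *\<^sub>v x) \<bullet> y = (\<Sum>i<n. \<Sum>j<m. cnj (A $$ (i, j)) * cnj (x $ j) * y $ i)"
    using carrier
    by (auto simp: scalar_prod_def sum_distrib_right atLeast0LessThan intro!: sum.cong)
  also have "\<dots> = (\<Sum>j<m. \<Sum>i<n. cnj (A $$ (i, j)) * cnj (x $ j) * y $ i)"
    by (rule sum.swap)
  also have "\<dots> = conjugate x \<bullet> (mat_adjoint A *\<^sub>v y)"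
    using carrier
    by (auto simp: scalar_prod_def sum_distrib_left atLeast0LessThan mat_adjoint_index[OF A]
        algebra_simps intro!: sum.cong)
  finally show ?thesis .
qed

text \<open>
  The columns of \<open>U\<close> and of \<open>V\<close> are dual bases, so pairing \<open>V *\<^sub>v x\<close> with \<open>U *\<^sub>v y\<close> only sees the
  coordinates.
\<close>

lemma scalar_prod_dual_basis:
  fixes U V :: "complex mat"
  assumes U: "U \<in> carrier_mat n n" and V: "V \<in> carrier_mat n n"
    and dual: "mat_adjoint V * U = 1\<^sub>m n"
    and x: "x \<in> carrier_vec n" and y: "y \<in> carrier_vec n"
  shows "conjugate (V *\<^sub>v x) \<bullet> (U *\<^sub>v y) = conjugate x \<bullet> y"
proof -
  have "conjugate (V *\<^sub>v x) \<bullet> (U *\<^sub>v y) = conjugate x \<bullet> (mat_adjoint V *\<^sub>v (U *\<^sub>v y))"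
    using U V x y by (intro scalar_prod_mat_adjoint) auto
  also have "mat_adjoint V *\<^sub>v (U *\<^sub>v y) = (mat_adjoint V * U) *\<^sub>v y"
    using assoc_mult_mat_vec[OF mat_adjoint_carrier[OF V] U y] by simp
  also have "\<dots> = y"
    using dual y by simp
  finally show ?thesis .
qed

lemma diagonalized_mult_vec:
  fixes U V :: "complex mat"
  assumes U: "U \<in> carrier_mat n n" and V: "V \<in> carrier_mat n n"
    and dual: "mat_adjoint V * U = 1\<^sub>m n" and y: "y \<in> carrier_vec n"
  shows "(U * mat_diag n e * mat_adjoint V) *\<^sub>v (U *\<^sub>v y) = U *\<^sub>v (vec n (\<lambda>l. e l * y $ l))"
proof -
  note W = mat_adjoint_carrier[OF V]
  have D: "mat_diag n e \<in> carrier_mat n n" by simp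
  have "(U * mat_diag n e * mat_adjoint V) *\<^sub>v (U *\<^sub>v y)
      = (U * mat_diag n e) *\<^sub>v (mat_adjoint V *\<^sub>v (U *\<^sub>v y))"
    using U W y by (intro assoc_mult_mat_vec[of _ n n _ n]) auto
  also have "mat_adjoint V *\<^sub>v (U *\<^sub>v y) = (mat_adjoint V * U) *\<^sub>v y"
    using assoc_mult_mat_vec[OF W U y] by simp
  also have "\<dots> = y"
    using dual y by simp
  also have "(U * mat_diag n e) *\<^sub>v y = U *\<^sub>v (mat_diag n e *\<^sub>v y)"
    by (rule assoc_mult_mat_vec[OF U D y])
  also have "mat_diag n e *\<^sub>v y = vec n (\<lambda>l. e l * y $ l)"
    using y by (auto simp: mat_diag_def scalar_prod_def if_distrib[of "\<lambda>z. z * _"] cong: if_cong)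
  finally show ?thesis .
qed

section \<open>Indicator vectors and zero blocks\<close>

lemma conjugate_indicator_vec:
  "indicator_vec n f \<Longrightarrow> conjugate f = f"
  unfolding indicator_vec_def by (intro eq_vecI) force+

lemma sum_indicator_vec:
  assumes "indicator_vec n f"
  shows "(\<Sum>i<n. f $ i) = of_real ((norm2_vec f)\<^sup>2)"
proof -
  have f: "f \<in> carrier_vec n" "\<And>i. i < n \<Longrightarrow> f $ i = 0 \<or> f $ i = 1"
    using assms unfolding indicator_vec_def by auto
  have "(norm2_vec f)\<^sup>2 = (\<Sum>i<n. (cmod (f $ i))\<^sup>2)"
    using f(1) unfolding norm2_vec_def L2_set_def by (simp add: sum_nonneg)
  moreover have "f $ i = of_real ((cmod (f $ i))\<^sup>2)" if "i < n" for i
    using f(2)[OF that] by auto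
  ultimately show ?thesis
    by simp
qed

lemma scalar_prod_zero_block:
  assumes B: "B \<in> carrier_mat n n" and ind: "indicator_vec n f" "indicator_vec n g"
    and block: "zero_block n B f g"
  shows "f \<bullet> (B *\<^sub>v g) = 0"
proof -
  have f: "f \<in> carrier_vec n" "\<And>i. i < n \<Longrightarrow> f $ i = 0 \<or> f $ i = 1"
    and g: "g \<in> carrier_vec n" "\<And>i. i < n \<Longrightarrow> g $ i = 0 \<or> g $ i = 1"
    using ind unfolding indicator_vec_def by auto
  have "f $ i * (B $$ (i, j) * g $ j) = 0" if "i < n" "j < n" for i j
    using f(2)[OF that(1)] g(2)[OF that(2)] block that unfolding zero_block_def by auto
  moreover have "f \<bullet> (B *\<^sub>v g) = (\<Sum>i<n. \<Sum>j<n. f $ i * (B $$ (i, j) * g $ j))"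
    using B f(1) g(1)
    by (auto simp: scalar_prod_def sum_distrib_left atLeast0LessThan intro!: sum.cong)
  ultimately show ?thesis
    by (auto intro!: sum.neutral)
qed

section \<open>The constant eigenvectors\<close>

lemma mat_mult_unit_vec_eq_col:
  fixes A :: "complex mat"
  assumes A: "A \<in> carrier_mat n m" and k: "k < m"
  shows "A *\<^sub>v unit_vec m k = col A k"
  using A k by (intro eq_vecI) auto

text \<open>
  The scalars \<open>a\<close> and \<open>b\<close> are free up to the normalization \<open>b\<^sup>* * a * n = 1\<close> coming from
  \<open>V\<^sup>* U = I\<close>; this is why the product of the two coefficients, unlike each of them, is
  determined by \<open>f\<close> and \<open>g\<close>.
\<close>

lemma constant_eigenpair_coefficients:
  fixes U V :: "complex mat"
  assumes U: "U \<in> carrier_mat n n" and V: "V \<in> carrier_mat n n"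
    and dual: "mat_adjoint V * U = 1\<^sub>m n"
    and F: "F \<in> carrier_vec n" and G: "G \<in> carrier_vec n"
    and k: "k < n"
    and colU: "col U k = a \<cdot>\<^sub>v vec n (\<lambda>_. 1)" and colV: "col V k = b \<cdot>\<^sub>v vec n (\<lambda>_. 1)"
  shows "a \<noteq> 0"
    and "F $ k * G $ k
      = (\<Sum>i<n. conjugate (V *\<^sub>v conjugate F) $ i) * (\<Sum>i<n. (U *\<^sub>v G) $ i) / of_nat n"
proof -
  let ?e = "unit_vec n k :: complex vec"
  have Ue: "U *\<^sub>v ?e = a \<cdot>\<^sub>v vec n (\<lambda>_. 1)" and Ve: "V *\<^sub>v ?e = b \<cdot>\<^sub>v vec n (\<lambda>_. 1)"
    using mat_mult_unit_vec_eq_col[OF U k] mat_mult_unit_vec_eq_col[OF V k] colU colV by auto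
  have conj_e: "conjugate ?e = ?e"
    using k by (intro eq_vecI) auto
  note pair = scalar_prod_dual_basis[OF U V dual]
  have "conjugate (V *\<^sub>v ?e) \<bullet> (U *\<^sub>v ?e) = 1"
    using pair[of ?e ?e] k by (simp add: conj_e)
  hence norm: "of_nat n * (cnj b * a) = 1"
    unfolding Ue Ve by (simp add: scalar_prod_def)
  thus "a \<noteq> 0"
    by auto
  have "conjugate (V *\<^sub>v conjugate F) \<bullet> (U *\<^sub>v ?e) = F $ k"
    using pair[of "conjugate F" ?e] F k by simp
  hence Fk: "F $ k = a * (\<Sum>i<n. conjugate (V *\<^sub>v conjugate F) $ i)"
    unfolding Ue using V
    by (simp add: scalar_prod_def sum_distrib_left atLeast0LessThan mult.commute)
  have "conjugate (V *\<^sub>v ?e) \<bullet> (U *\<^sub>v G) = G $ k"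
    using pair[of ?e G] G k by (simp add: conj_e)
  hence Gk: "G $ k = cnj b * (\<Sum>i<n. (U *\<^sub>v G) $ i)"
    unfolding Ve using U
    by (simp add: scalar_prod_def sum_distrib_left atLeast0LessThan)
  have "cnj b * a = 1 / of_nat n"
    using norm k by (simp add: eq_divide_eq mult.commute)
  thus "F $ k * G $ k
      = (\<Sum>i<n. conjugate (V *\<^sub>v conjugate F) $ i) * (\<Sum>i<n. (U *\<^sub>v G) $ i) / of_nat n"
    unfolding Fk Gk by (metis (no_types, lifting) mult.commute mult.left_commute mult_1_right
        times_divide_eq_right)
qed

text \<open>
  By the row sums, \<open>B\<close> multiplies the constant vector by \<open>d\<close>; by the decomposition, it multiplies
  column \<open>k\<close> of \<open>U\<close> by \<open>eigs k\<close>.  These are the same vector up to the nonzero factor \<open>a\<close>.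
\<close>

lemma constant_eigenvector_eigenvalue:
  fixes U V :: "complex mat"
  assumes U: "U \<in> carrier_mat n n" and V: "V \<in> carrier_mat n n"
    and dual: "mat_adjoint V * U = 1\<^sub>m n"
    and B: "B = U * mat_diag n eigs * mat_adjoint V" and reg: "regular_matrix n d B"
    and k: "k < n" and colU: "col U k = a \<cdot>\<^sub>v vec n (\<lambda>_. 1)" and a: "a \<noteq> 0"
  shows "eigs k = of_nat d"
proof -
  let ?e = "unit_vec n k :: complex vec"
  have Bc: "B \<in> carrier_mat n n" and rows: "\<And>i. i < n \<Longrightarrow> (\<Sum>j<n. B $$ (i, j)) = of_nat d"
    using reg unfolding regular_matrix_def by auto
  have Ue: "U *\<^sub>v ?e = a \<cdot>\<^sub>v vec n (\<lambda>_. 1)"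
    using mat_mult_unit_vec_eq_col[OF U k] colU by simp
  have "vec n (\<lambda>l. eigs l * ?e $ l) = eigs k \<cdot>\<^sub>v ?e"
    using k by (intro eq_vecI) auto
  hence "B *\<^sub>v (U *\<^sub>v ?e) = U *\<^sub>v (eigs k \<cdot>\<^sub>v ?e)"
    unfolding B using diagonalized_mult_vec[OF U V dual, of ?e eigs] by simp
  also have "\<dots> = eigs k \<cdot>\<^sub>v (U *\<^sub>v ?e)"
    using U by (intro mult_mat_vec) auto
  finally have "(B *\<^sub>v (a \<cdot>\<^sub>v vec n (\<lambda>_. 1))) $ k = (eigs k \<cdot>\<^sub>v (a \<cdot>\<^sub>v vec n (\<lambda>_. 1))) $ k"
    unfolding Ue by simp
  hence "(\<Sum>j<n. B $$ (k, j)) * a = eigs k * a"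
    using k Bc by (simp add: scalar_prod_def sum_distrib_right atLeast0LessThan)
  thus ?thesis
    using a rows[OF k] by simp
qed

section \<open>Nonnegative weights balanced by real numbers\<close>

text \<open>
  Only the index \<open>k\<close> is treated exactly; everywhere else \<open>\<alpha>\<close> is replaced by its minimum \<open>m\<close>.
  Balance also gives \<open>m * (\<Sum>l\<in>A. w l) \<le> 0\<close>, so \<open>m > 0\<close> makes all weights vanish, and otherwise the
  denominator \<open>c - m\<close> is positive.
\<close>

lemma weight_le_of_balanced_sum:
  fixes \<alpha> w :: "'a \<Rightarrow> real"
  assumes fin: "finite A" and k: "k \<in> A" and nonneg: "\<And>l. l \<in> A \<Longrightarrow> 0 \<le> w l"
    and balanced: "(\<Sum>l\<in>A. \<alpha> l * w l) = 0"
    and c: "0 < c" "\<alpha> k * w k = c * w k"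
  shows "w k \<le> - Min (\<alpha> ` A) * (\<Sum>l\<in>A. w l) / (c - Min (\<alpha> ` A))"
proof -
  let ?m = "Min (\<alpha> ` A)" and ?S = "\<Sum>l\<in>A. w l"
  have below: "?m * w l \<le> \<alpha> l * w l" if "l \<in> A" for l
    using fin that nonneg by (intro mult_right_mono) auto
  have wk: "0 \<le> w k" "w k \<le> ?S"
    using nonneg k fin by (auto intro: member_le_sum)
  have mS: "?m * ?S \<le> 0"
    using sum_mono[of A "\<lambda>l. ?m * w l" "\<lambda>l. \<alpha> l * w l"] below balanced
    by (simp add: sum_distrib_left)
  have "?m * (\<Sum>l\<in>A - {k}. w l) \<le> (\<Sum>l\<in>A - {k}. \<alpha> l * w l)"
    using below by (auto simp: sum_distrib_left intro: sum_mono)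
  hence "?m * (?S - w k) \<le> - (c * w k)"
    using balanced c(2) by (simp add: sum_diff1 fin k)
  hence main: "w k * (c - ?m) \<le> - ?m * ?S"
    by (simp add: algebra_simps)
  show ?thesis
  proof (cases "?m > 0")
    case True
    with mS have "?S \<le> 0"
      by (simp add: mult_le_0_iff)
    with wk have "?S = 0" "w k = 0"
      by auto
    thus ?thesis
      by simp
  next
    case False
    with c(1) have "0 < c - ?m"
      by simp
    with main show ?thesis
      by (simp only: pos_le_divide_eq)
  qed
qed

section \<open>The bound on zero blocks\<close>

theorem corollary3p5:
  fixes n d :: nat
    and E :: "(nat \<times> nat) set"
    and B U V :: "complex mat"
    and eigs :: "nat \<Rightarrow> complex"
    and \<alpha> \<theta> :: "nat \<Rightarrow> real"
    and f g F G :: "complex vec"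
  assumes graph: "0 < n" "E \<subseteq> {..<n} \<times> {..<n}" "B = adjacency_matrix n E"
    and regular: "regular_matrix n d B" "0 < d"
    and decomposition: "U \<in> carrier_mat n n" "V \<in> carrier_mat n n"
      "B = U * mat_diag n eigs * mat_adjoint V"
      "U * mat_adjoint V = 1\<^sub>m n"
    and constant_eigenpair: "has_constant_eigenpair n U V"
    and polar: "\<forall>l<n. 0 \<le> \<theta> l \<and> \<theta> l < 2 * pi
                  \<and> eigs l = of_real (\<alpha> l) * exp (\<i> * of_real (\<theta> l))"
    and indicators: "indicator_vec n f" "indicator_vec n g"
    and coefficients: "F \<in> carrier_vec n" "G \<in> carrier_vec n"
      "f = V *\<^sub>v conjugate F" "g = U *\<^sub>v G"
      "\<forall>l<n. F $ l * G $ l * exp (\<i> * of_real (\<theta> l)) \<ge> 0"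
    and block: "zero_block n B f g"
  shows "of_real ((norm2_vec f)\<^sup>2 * (norm2_vec g)\<^sup>2 / of_nat n)
       \<le> - of_real (Min (\<alpha> ` {..<n})) * (\<Sum>l<n. F $ l * G $ l * exp (\<i> * of_real (\<theta> l)))
            / of_real (of_nat d - Min (\<alpha> ` {..<n}))"
proof -
  have Bc: "B \<in> carrier_mat n n"
    using regular(1) unfolding regular_matrix_def by simp
  have dual: "mat_adjoint V * U = 1\<^sub>m n"
    using mat_mult_left_right_inverse[OF decomposition(1) mat_adjoint_carrier[OF decomposition(2)]
        decomposition(4)] .
  define z where "z l = F $ l * G $ l * exp (\<i> * of_real (\<theta> l))" for l
  define w where "w l = Re (z l)" for l
  have z: "z l = of_real (w l)" and w_nonneg: "0 \<le> w l" if "l < n" for l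
    using coefficients(5) that
    by (auto simp: z_def w_def less_eq_complex_def complex_eq_iff)
  have weighted: "eigs l * (F $ l * G $ l) = of_real (\<alpha> l * w l)" if "l < n" for l
    using polar that z[OF that] by (simp add: z_def algebra_simps)

  have "0 = conjugate f \<bullet> (B *\<^sub>v g)"
    using scalar_prod_zero_block[OF Bc indicators block] conjugate_indicator_vec[OF indicators(1)]
    by simp
  also have "B *\<^sub>v g = U *\<^sub>v vec n (\<lambda>l. eigs l * G $ l)"
    unfolding decomposition(3) coefficients(4)
    by (rule diagonalized_mult_vec[OF decomposition(1,2) dual coefficients(2)])
  also have "conjugate f \<bullet> \<dots> = F \<bullet> vec n (\<lambda>l. eigs l * G $ l)"
    unfolding coefficients(3)
    using scalar_prod_dual_basis[OF decomposition(1,2) dual, of "conjugate F"] coefficients(1)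
    by simp
  also have "\<dots> = (\<Sum>l<n. eigs l * (F $ l * G $ l))"
    by (simp add: scalar_prod_def atLeast0LessThan algebra_simps)
  also have "\<dots> = of_real (\<Sum>l<n. \<alpha> l * w l)"
    by (simp add: weighted)
  finally have balanced: "(\<Sum>l<n. \<alpha> l * w l) = 0"
    by (metis of_real_eq_0_iff)

  obtain k a b where k: "k < n"
    and cols: "col U k = a \<cdot>\<^sub>v vec n (\<lambda>_. 1)" "col V k = b \<cdot>\<^sub>v vec n (\<lambda>_. 1)"
    using constant_eigenpair unfolding has_constant_eigenpair_def by blast
  note at_k = constant_eigenpair_coefficients[OF decomposition(1,2) dual coefficients(1,2) k cols]
  define P where "P = (norm2_vec f)\<^sup>2 * (norm2_vec g)\<^sup>2 / of_nat n"
  have FG: "F $ k * G $ k = of_real P"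
    using at_k(2)
    unfolding coefficients(3,4)[symmetric] conjugate_indicator_vec[OF indicators(1)]
      sum_indicator_vec[OF indicators(1)] sum_indicator_vec[OF indicators(2)]
    by (simp add: P_def)
  \<comment> \<open>Two nonnegative reals that differ by a factor of modulus one are equal.\<close>
  have "cmod (z k) = cmod (F $ k * G $ k)"
    by (simp add: z_def norm_mult)
  moreover have "0 \<le> P"
    by (simp add: P_def)
  ultimately have P: "w k = P"
    using z[OF k] w_nonneg[OF k] FG by simp
  have "eigs k = of_nat d"
    using constant_eigenvector_eigenvalue[OF decomposition(1,2) dual decomposition(3) regular(1)
        k cols(1) at_k(1)] .
  hence "(of_real (\<alpha> k * w k) :: complex) = of_real (real d * w k)"
    using weighted[OF k] FG P by auto
  hence "\<alpha> k * w k = real d * w k"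
    by (simp only: of_real_eq_iff)
  hence "w k \<le> - Min (\<alpha> ` {..<n}) * (\<Sum>l<n. w l) / (real d - Min (\<alpha> ` {..<n}))"
    using k w_nonneg balanced regular(2) by (intro weight_le_of_balanced_sum) auto
  hence "complex_of_real P
      \<le> of_real (- Min (\<alpha> ` {..<n}) * (\<Sum>l<n. w l) / (real d - Min (\<alpha> ` {..<n})))"
    unfolding P by (simp only: less_eq_complex_def Re_complex_of_real Im_complex_of_real simp_thms)
  moreover have "(\<Sum>l<n. F $ l * G $ l * exp (\<i> * of_real (\<theta> l))) = of_real (\<Sum>l<n. w l)"
    using z by (simp add: z_def)
  ultimately show ?thesis
    unfolding P_def by simp
qed

end
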